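(* Let $\lambda>0$, let $\bm{M}^\star$ be the optimal solution of $\min_{\bm{M}\succeq\bm{O}}P_\lambda(\bm{M})$, let $\bm{M}\succeq\bm{O}$ be any feasible solution, and let $\nabla P_\lambda(\bm{M})$ be any subgradient of $P_\lambda$ at $\bm{M}$. Then $$\left\|\bm{M}^\star-\bm{Q}^{\mathrm{GB}}(\bm{M})\right\|_F^2\le\left(\frac{1}{2\lambda}\left\|\nabla P_{\lambda}(\bm{M})\right\|_F\right)^2,\qquad \bm{Q}^{\mathrm{GB}}(\bm{M}):=\bm{M}-\frac{1}{2\lambda}\nabla P_{\lambda}(\bm{M}).$$
   Context: Let $\bm{x}_1,\dots,\bm{x}_n\in\mathbb{R}^d$ have labels $y_1,\dots,y_n$ in a discrete set, and let $\mathcal{T}=\{(i,j,l)\in\{1,\dots,n\}^3\mid y_i=y_j,\ i\neq j,\ y_i\neq y_l\}$. For $(i,j,l)\in\mathcal{T}$ put $\bm{H}_{ijl}=(\bm{x}_i-\bm{x}_l)(\bm{x}_i-\bm{x}_l)^\top-(\bm{x}_i-\bm{x}_j)(\bm{x}_i-\bm{x}_j)^\top$. $\langle \bm{A},\bm{B}\rangle=\mathrm{tr}(\bm{A}^\top\bm{B})$, $\|\bm{A}\|_F^2=\langle\bm{A},\bm{A}\rangle$, and $\bm{M}\succeq\bm{O}$ means that $\bm{M}\in\mathbb{R}^{d\times d}$ is (symmetric) positive semi-definite. The loss $\ell:\mathbb{R}\to\mathbb{R}$ is either the hinge loss $\ell(x)=\max\{0,1-x\}$ (parameter $\gamma=0$),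 or, for a parameter $\gamma>0$, the smoothed hinge loss: $\ell(x)=0$ for $x>1$, $\ell(x)=\frac{1}{2\gamma}(1-x)^2$ for $1-\gamma\le x\le1$, $\ell(x)=1-x-\frac{\gamma}{2}$ for $x<1-\gamma$. The primal objective is $P_\lambda(\bm{M})=\sum_{(i,j,l)\in\mathcal{T}}\ell(\langle\bm{M},\bm{H}_{ijl}\rangle)+\frac{\lambda}{2}\|\bm{M}\|_F^2$. A subgradient $\nabla P_\lambda(\bm{M})$ is a matrix of the form $\sum_{(i,j,l)\in\mathcal{T}}g_{ijl}\bm{H}_{ijl}+\lambda\bm{M}$ with $g_{ijl}\in\partial\ell(\langle\bm{M},\bm{H}_{ijl}\rangle)$. *)

theory Defs
  imports "HOL-Analysis.Analysis"
begin

definition frob_inner :: "real^'d^'d \<Rightarrow> real^'d^'d \<Rightarrow> real" where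
  "frob_inner A B = trace (transpose A ** B)"

definition frob_norm :: "real^'d^'d \<Rightarrow> real" where
  "frob_norm A = sqrt (frob_inner A A)"

definition psd :: "real^'d^'d \<Rightarrow> bool" where
  "psd M \<longleftrightarrow> transpose M = M \<and> (\<forall>v. 0 \<le> v \<bullet> (M *v v))"

definition outer :: "real^'d \<Rightarrow> real^'d^'d" where
  "outer v = (columnvector v :: real^1^'d) ** (rowvector v :: real^'d^1)"

definition triplets :: "nat \<Rightarrow> (nat \<Rightarrow> 'l) \<Rightarrow> (nat \<times> nat \<times> nat) set" where
  "triplets n y = {(i, j, l). i \<in> {1..n} \<and> j \<in> {1..n} \<and> l \<in> {1..n} \<and>
     y i = y j \<and> i \<noteq> j \<and> y i \<noteq> y l}"

definition H :: "(nat \<Rightarrow> real^'d) \<Rightarrow> nat \<times> nat \<times> nat \<Rightarrow> real^'d^'d" where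
  "H x = (\<lambda>(i, j, l). outer (x i - x l) - outer (x i - x j))"

definition hinge :: "real \<Rightarrow> real" where
  "hinge x = max 0 (1 - x)"

definition smoothed_hinge :: "real \<Rightarrow> real \<Rightarrow> real" where
  "smoothed_hinge \<gamma> x =
     (if x > 1 then 0
      else if 1 - \<gamma> \<le> x then 1 / (2 * \<gamma>) * (1 - x)\<^sup>2
      else 1 - x - \<gamma> / 2)"

text \<open>The parameter value \<open>\<gamma> = 0\<close> selects the unsmoothed hinge loss; only \<open>\<gamma> \<ge> 0\<close> is meaningful.\<close>

definition loss :: "real \<Rightarrow> real \<Rightarrow> real" where
  "loss \<gamma> = (if \<gamma> = 0 then hinge else smoothed_hinge \<gamma>)"

definition subdiff :: "(real \<Rightarrow> real) \<Rightarrow> real \<Rightarrow> real set" where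
  "subdiff f x = {g. \<forall>z. f z \<ge> f x + g * (z - x)}"

definition primal ::
  "nat \<Rightarrow> (nat \<Rightarrow> real^'d) \<Rightarrow> (nat \<Rightarrow> 'l) \<Rightarrow> real \<Rightarrow> real \<Rightarrow> real^'d^'d \<Rightarrow> real" where
  "primal n x y \<gamma> lam M =
     (\<Sum>t\<in>triplets n y. loss \<gamma> (frob_inner M (H x t))) + lam / 2 * (frob_norm M)\<^sup>2"

definition primal_subgradients ::
  "nat \<Rightarrow> (nat \<Rightarrow> real^'d) \<Rightarrow> (nat \<Rightarrow> 'l) \<Rightarrow> real \<Rightarrow> real \<Rightarrow> real^'d^'d \<Rightarrow> (real^'d^'d) set" where
  "primal_subgradients n x y \<gamma> lam M =
     {(\<Sum>t\<in>triplets n y. g t *\<^sub>R H x t) + lam *\<^sub>R M | g.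
        \<forall>t\<in>triplets n y. g t \<in> subdiff (loss \<gamma>) (frob_inner M (H x t))}"

text \<open>Centre of the gradient bound sphere, where \<open>G\<close> is the chosen subgradient at \<open>M\<close>.\<close>

definition Q_GB :: "real \<Rightarrow> real^'d^'d \<Rightarrow> real^'d^'d \<Rightarrow> real^'d^'d" where
  "Q_GB lam G M = M - (1 / (2 * lam)) *\<^sub>R G"

text \<open>The trace form is the inner product that the library puts on \<open>real^'d^'d\<close>.\<close>

lemma frob_inner_eq_inner: "frob_inner A B = A \<bullet> B"
  unfolding frob_inner_def trace_def transpose_def matrix_matrix_mult_def inner_vec_def
  by (simp, rule sum.swap)

lemma frob_norm_eq_norm: "frob_norm A = norm A"
  by (simp add: frob_norm_def frob_inner_eq_inner norm_eq_sqrt_inner)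

end

theory Submission
  imports Defs
begin

text \<open>Put \<open>D = \<parallel>M - M\<^sup>\<star>\<parallel>\<^sup>2\<close>. The objective is \<open>\<lambda>\<close>-strongly convex, so the subgradient
  inequality at \<open>M\<close> improves to \<open>P M\<^sup>\<star> \<ge> P M + \<langle>G, M\<^sup>\<star> - M\<rangle> + \<lambda>/2 D\<close>, and optimality of
  \<open>M\<^sup>\<star>\<close> over a convex set to \<open>P M \<ge> P M\<^sup>\<star> + \<lambda>/2 D\<close>. Adding the two gives
  \<open>\<lambda> D \<le> \<langle>G, M - M\<^sup>\<star>\<rangle>\<close>, which is the claimed ball after completing the square.\<close>

text \<open>The last term is the exact gap in the convexity of the squared norm; it supplies the
  quadratic growth below.\<close>

lemma power2_norm_convex_comb:
  fixes a b :: "'a::real_inner"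
  shows "(norm ((1 - t) *\<^sub>R a + t *\<^sub>R b))\<^sup>2
    = (1 - t) * (norm a)\<^sup>2 + t * (norm b)\<^sup>2 - t * (1 - t) * (norm (b - a))\<^sup>2"
  by (simp add: power2_norm_eq_inner inner_simps inner_commute[of b a]) algebra

text \<open>Minimality is tested only on the segment from \<open>a\<close> to \<open>b\<close>, so
  \<open>f\<close> needs no derivative: divide by the weight of \<open>b\<close> and let that weight
  tend to 0.\<close>

lemma strongly_convex_arg_min_growth:
  fixes f :: "'a::real_inner \<Rightarrow> real"
  assumes f: "convex_on UNIV f" and S: "convex S" "a \<in> S" "b \<in> S"
    and min: "\<And>c. c \<in> S \<Longrightarrow> f a + lam / 2 * (norm a)\<^sup>2 \<le> f c + lam / 2 * (norm c)\<^sup>2"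
  shows "f a + lam / 2 * (norm a)\<^sup>2 + lam / 2 * (norm (b - a))\<^sup>2 \<le> f b + lam / 2 * (norm b)\<^sup>2"
proof -
  let ?P = "\<lambda>c. f c + lam / 2 * (norm c)\<^sup>2"
  \<comment> \<open>Here \<open>s\<close> is the weight of \<open>a\<close>; the factor
    \<open>s\<close> is removed afterwards by letting it tend to 1.\<close>
  have "s * (lam / 2 * (norm (b - a))\<^sup>2) \<le> ?P b - ?P a" if s: "0 < s" "s < 1" for s
  proof -
    define t where "t = 1 - s"
    then have t: "0 < t" "t < 1" and "s = 1 - t"
      using s by auto
    let ?c = "(1 - t) *\<^sub>R a + t *\<^sub>R b"
    have "?c \<in> S"
      using S t by (simp add: convexD)
    then have "?P a \<le> ?P ?c"
      by (rule min)
    also have "\<dots> \<le> (1 - t) * f a + t * f b + lam / 2 * (norm ?c)\<^sup>2"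
      using convex_onD[OF f, of t a b] t by simp
    also have "\<dots> = ?P a + t * (?P b - ?P a - s * (lam / 2 * (norm (b - a))\<^sup>2))"
      unfolding power2_norm_convex_comb \<open>s = 1 - t\<close> by (simp add: field_simps)
    finally have "0 \<le> t * (?P b - ?P a - s * (lam / 2 * (norm (b - a))\<^sup>2))"
      by simp
    then show ?thesis
      using t by (simp add: zero_le_mult_iff)
  qed
  then have "lam / 2 * (norm (b - a))\<^sup>2 \<le> ?P b - ?P a"
    by (rule field_le_mult_one_interval)
  then show ?thesis
    by simp
qed

lemma convex_psd: "convex (Collect psd)"
proof (rule convexI)
  fix A B :: "real^'d^'d" and u v :: real
  assume AB: "A \<in> Collect psd" "B \<in> Collect psd" and uv: "0 \<le> u" "0 \<le> v"
  have "transpose (u *\<^sub>R A + v *\<^sub>R B) = u *\<^sub>R transpose A + v *\<^sub>R transpose B"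
    by (simp add: vec_eq_iff transpose_def)
  moreover have "w \<bullet> ((u *\<^sub>R A + v *\<^sub>R B) *v w) = u * (w \<bullet> (A *v w)) + v * (w \<bullet> (B *v w))" for w
    by (simp add: matrix_vector_mult_add_rdistrib scaleR_matrix_vector_assoc[symmetric] inner_simps)
  ultimately show "u *\<^sub>R A + v *\<^sub>R B \<in> Collect psd"
    using AB uv by (simp add: psd_def)
qed

text \<open>The loss is the Fenchel conjugate \<open>\<ell> z = (MAX a\<in>{0..1}. a * (1 - z) - \<gamma>/2 * a\<^sup>2)\<close>; this form
  covers \<open>\<gamma> = 0\<close> as well and exhibits convexity.\<close>

lemma loss_ge_affine:
  assumes "\<gamma> \<ge> 0" "0 \<le> a" "a \<le> 1"
  shows "a * (1 - z) - \<gamma> / 2 * a\<^sup>2 \<le> loss \<gamma> z"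
proof (cases "\<gamma> = 0")
  case True
  have "a * (1 - z) \<le> max 0 (1 - z)"
    using assms by (cases "z \<le> 1") (auto simp: mult_left_le_one_le mult_nonneg_nonpos max_def)
  then show ?thesis
    by (simp add: True loss_def hinge_def)
next
  case False
  then have \<gamma>: "\<gamma> > 0"
    using assms by simp
  consider "z > 1" | "z \<le> 1" "1 - \<gamma> \<le> z" | "z < 1 - \<gamma>" "z \<le> 1"
    using \<gamma> by linarith
  then show ?thesis
  proof cases
    case 1
    then have "a * (1 - z) \<le> 0" "0 \<le> \<gamma> / 2 * a\<^sup>2"
      using assms by (auto simp: mult_nonneg_nonpos)
    then show ?thesis
      using 1 False by (simp add: loss_def smoothed_hinge_def)
  next
    case 2
    \<comment> \<open>Complete the square in \<open>a\<close>; the gap vanishes at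
      \<open>a = (1 - z) / \<gamma>\<close>.\<close>
    have "1 / (2 * \<gamma>) * (1 - z)\<^sup>2 - (a * (1 - z) - \<gamma> / 2 * a\<^sup>2) = (1 - z - \<gamma> * a)\<^sup>2 / (2 * \<gamma>)"
      using \<gamma> by (simp add: field_simps power2_eq_square)
    also have "\<dots> \<ge> 0"
      using \<gamma> by simp
    finally show ?thesis
      using 2 False by (simp add: loss_def smoothed_hinge_def)
  next
    case 3
    \<comment> \<open>The vertex \<open>(1 - z) / \<gamma>\<close> now exceeds 1, so the maximum
      sits at \<open>a = 1\<close>; expand around that point.\<close>
    have "1 - z - \<gamma> / 2 - (a * (1 - z) - \<gamma> / 2 * a\<^sup>2)
        = (1 - a) * (1 - z - \<gamma>) + \<gamma> / 2 * (1 - a)\<^sup>2"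
      by (simp add: field_simps power2_eq_square)
    also have "\<dots> \<ge> 0"
      using assms 3 by simp
    finally show ?thesis
      using 3 False by (simp add: loss_def smoothed_hinge_def)
  qed
qed

text \<open>The maximiser \<open>a\<close> is minus a slope of the loss at \<open>z\<close>: 0 on
  the flat part, 1 on the linear part, \<open>(1 - z) / \<gamma>\<close> in between.\<close>

lemma loss_eq_affine:
  assumes "\<gamma> \<ge> 0"
  obtains a where "0 \<le> a" "a \<le> 1" "loss \<gamma> z = a * (1 - z) - \<gamma> / 2 * a\<^sup>2"
proof -
  \<comment> \<open>The hinge kink \<open>z = 1\<close> joins the linear part, which keeps the
    division by \<gamma> safe.\<close>
  consider "z > 1" | "z < 1 - \<gamma> \<or> z \<le> 1 \<and> \<gamma> = 0" | "z \<le> 1" "1 - \<gamma> \<le> z" "\<gamma> > 0"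
    using assms by linarith
  then show thesis
  proof cases
    case 1
    then show thesis
      by (intro that[of 0]) (auto simp: loss_def hinge_def smoothed_hinge_def)
  next
    case 2
    then show thesis
      using assms by (intro that[of 1]) (auto simp: loss_def hinge_def smoothed_hinge_def)
  next
    case 3
    then show thesis
      by (intro that[of "(1 - z) / \<gamma>"])
        (auto simp: loss_def smoothed_hinge_def field_simps power2_eq_square)
  qed
qed

text \<open>The affine minorant that is exact at the intermediate point lies below the loss at both
  endpoints.\<close>

lemma convex_on_loss:
  assumes "\<gamma> \<ge> 0"
  shows "convex_on UNIV (loss \<gamma>)"
proof (rule convex_onI)
  fix t p q :: real
  assume t: "0 < t" "t < 1"
  obtain a where a: "0 \<le> a" "a \<le> 1"
    and eq: "loss \<gamma> ((1 - t) *\<^sub>R p + t *\<^sub>R q)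
      = a * (1 - ((1 - t) *\<^sub>R p + t *\<^sub>R q)) - \<gamma> / 2 * a\<^sup>2"
    using loss_eq_affine[OF assms] .
  have "loss \<gamma> ((1 - t) *\<^sub>R p + t *\<^sub>R q)
      = (1 - t) * (a * (1 - p) - \<gamma> / 2 * a\<^sup>2) + t * (a * (1 - q) - \<gamma> / 2 * a\<^sup>2)"
    unfolding eq by (simp add: field_simps)
  also have "\<dots> \<le> (1 - t) * loss \<gamma> p + t * loss \<gamma> q"
    using t by (intro add_mono mult_left_mono loss_ge_affine assms a) auto
  finally show "loss \<gamma> ((1 - t) *\<^sub>R p + t *\<^sub>R q) \<le> (1 - t) * loss \<gamma> p + t * loss \<gamma> q" .
qed simp

lemma convex_on_sum_loss:
  fixes h :: "'t \<Rightarrow> 'a::real_inner"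
  assumes "\<gamma> \<ge> 0"
  shows "convex_on UNIV (\<lambda>A. \<Sum>t\<in>T. loss \<gamma> (A \<bullet> h t))"
proof (rule convex_onI)
  fix s :: real and A B :: 'a
  assume s: "0 < s" "s < 1"
  have "loss \<gamma> (((1 - s) *\<^sub>R A + s *\<^sub>R B) \<bullet> h t)
      \<le> (1 - s) * loss \<gamma> (A \<bullet> h t) + s * loss \<gamma> (B \<bullet> h t)" for t
    using convex_onD[OF convex_on_loss[OF assms], of s "A \<bullet> h t" "B \<bullet> h t"] s
    by (simp add: inner_simps)
  then show "(\<Sum>t\<in>T. loss \<gamma> (((1 - s) *\<^sub>R A + s *\<^sub>R B) \<bullet> h t))
      \<le> (1 - s) * (\<Sum>t\<in>T. loss \<gamma> (A \<bullet> h t)) + s * (\<Sum>t\<in>T. loss \<gamma> (B \<bullet> h t))"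
    by (simp add: sum_distrib_left sum_mono flip: sum.distrib)
qed simp

text \<open>Each \<open>g t\<close> gives a supporting line of one loss term, while the regulariser
  expands exactly and leaves the quadratic surplus.\<close>

lemma primal_strong_subgradient:
  assumes "G \<in> primal_subgradients n x y \<gamma> lam M"
  shows "primal n x y \<gamma> lam M + G \<bullet> (N - M) + lam / 2 * (norm (N - M))\<^sup>2 \<le> primal n x y \<gamma> lam N"
proof -
  let ?T = "triplets n y"
  obtain g where G: "G = (\<Sum>t\<in>?T. g t *\<^sub>R H x t) + lam *\<^sub>R M"
    and g: "\<And>t. t \<in> ?T \<Longrightarrow> g t \<in> subdiff (loss \<gamma>) (frob_inner M (H x t))"
    using assms by (auto simp: primal_subgradients_def)
  have "(\<Sum>t\<in>?T. loss \<gamma> (M \<bullet> H x t)) + (\<Sum>t\<in>?T. g t *\<^sub>R H x t) \<bullet> (N - M)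
      = (\<Sum>t\<in>?T. loss \<gamma> (M \<bullet> H x t) + g t * (N \<bullet> H x t - M \<bullet> H x t))"
    by (simp add: inner_sum_left sum.distrib inner_diff_right inner_commute[of "H x _"]
        right_diff_distrib sum_subtractf)
  also have "\<dots> \<le> (\<Sum>t\<in>?T. loss \<gamma> (N \<bullet> H x t))"
    using g by (intro sum_mono) (simp add: subdiff_def frob_inner_eq_inner)
  finally have "(\<Sum>t\<in>?T. loss \<gamma> (M \<bullet> H x t)) + (\<Sum>t\<in>?T. g t *\<^sub>R H x t) \<bullet> (N - M)
      \<le> (\<Sum>t\<in>?T. loss \<gamma> (N \<bullet> H x t))" .
  moreover have "lam / 2 * (norm M)\<^sup>2 + (lam *\<^sub>R M) \<bullet> (N - M) + lam / 2 * (norm (N - M))\<^sup>2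
      = lam / 2 * (norm N)\<^sup>2"
    by (simp add: power2_norm_eq_inner inner_simps inner_commute[of N M] field_simps)
  ultimately show ?thesis
    by (simp add: G primal_def frob_inner_eq_inner frob_norm_eq_norm inner_add_left)
qed

theorem theorem3p2:
  fixes x :: "nat \<Rightarrow> real^'d" and y :: "nat \<Rightarrow> 'l" and n :: nat
    and \<gamma> lam :: real and Mstar M G :: "real^'d^'d"
  assumes "\<gamma> \<ge> 0"
    and "lam > 0"
    and "is_arg_min (primal n x y \<gamma> lam) psd Mstar"
    and "psd M"
    and "G \<in> primal_subgradients n x y \<gamma> lam M"
  shows "(frob_norm (Mstar - Q_GB lam G M))\<^sup>2 \<le> (1 / (2 * lam) * frob_norm G)\<^sup>2"
proof -
  let ?P = "primal n x y \<gamma> lam"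
  have min: "psd Mstar" "\<And>N. psd N \<Longrightarrow> ?P Mstar \<le> ?P N"
    using assms(3) by (auto simp: is_arg_min_linorder)
  have "?P Mstar + lam / 2 * (norm (M - Mstar))\<^sup>2 \<le> ?P M"
    using strongly_convex_arg_min_growth[OF convex_on_sum_loss[OF assms(1), of "H x" "triplets n y"]
        convex_psd, of Mstar M lam] min assms(4)
    by (simp add: primal_def frob_inner_eq_inner frob_norm_eq_norm)
  moreover have "?P M + G \<bullet> (Mstar - M) + lam / 2 * (norm (Mstar - M))\<^sup>2 \<le> ?P Mstar"
    by (rule primal_strong_subgradient[OF assms(5)])
  ultimately have key: "lam * (norm (Mstar - M))\<^sup>2 + G \<bullet> (Mstar - M) \<le> 0"
    by (simp add: norm_minus_commute)
  define D where "D = Mstar - M"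
  define c where "c = 1 / (2 * lam)"
  have "Mstar - Q_GB lam G M = D + c *\<^sub>R G"
    by (simp add: Q_GB_def D_def c_def)
  then have "(norm (Mstar - Q_GB lam G M))\<^sup>2 = (norm D)\<^sup>2 + 2 * c * (G \<bullet> D) + (c * norm G)\<^sup>2"
    by (simp add: power2_norm_eq_inner power_mult_distrib inner_simps inner_commute[of D G])
      (simp add: power2_eq_square algebra_simps)
  \<comment> \<open>Since \<open>2 * c = 1 / lam\<close>, the first two terms are exactly the left
    side of \<open>key\<close> divided by \<open>lam\<close>.\<close>
  also have "\<dots> = (lam * (norm D)\<^sup>2 + G \<bullet> D) / lam + (1 / (2 * lam) * norm G)\<^sup>2"
    using assms(2) by (simp add: c_def add_divide_distrib)
  also have "\<dots> \<le> (1 / (2 * lam) * norm G)\<^sup>2"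
    using key assms(2) by (simp add: D_def divide_nonpos_pos)
  finally show ?thesis
    by (simp add: frob_norm_eq_norm)
qed

end
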